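(* Let $\mathcal{H}$ be a complex Hilbert space and let $T\in\mathcal{B}(\mathcal{H})$. Then the following inequalities hold: (i) $dw^2(T)\geq \max\left\{w^2(T)+c^2(T^*T),\ \|T\|^4+c^2(T)\right\}$; (ii) $dw^2(T)\geq 2\max\left\{w(T)\,c(T^*T),\ c(T)\,\|T\|^2\right\}$.
   Context: $\mathcal{B}(\mathcal{H})$ is the algebra of bounded linear operators on the complex Hilbert space $\mathcal{H}$, with operator norm $\|\cdot\|$. For $T\in\mathcal{B}(\mathcal{H})$: the numerical radius is $w(T)=\sup\{|\langle Tx,x\rangle|: x\in\mathcal{H},\|x\|=1\}$; the Crawford number is $c(T)=\inf\{|\langle Tx,x\rangle|: x\in\mathcal{H},\|x\|=1\}$; the Davis-Wielandt radius is $dw(T)=\sup\{\sqrt{|\langle Tx,x\rangle|^2+\|Tx\|^4}: x\in\mathcal{H},\|x\|=1\}$. Powers such as $dw^2(T)$, $w^2(T)$, $c^2(T)$ mean $(dw(T))^2$, $(w(T))^2$, $(c(T))^2$. *)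

theory Defs
  imports "HOL-Analysis.Operator_Norm"
begin

class complex_vector = real_vector +
  fixes scaleC :: "complex \<Rightarrow> 'a \<Rightarrow> 'a"  (infixr "*\<^sub>C" 75)
  assumes scaleC_add_right: "a *\<^sub>C (x + y) = a *\<^sub>C x + a *\<^sub>C y"
    and scaleC_add_left: "(a + b) *\<^sub>C x = a *\<^sub>C x + b *\<^sub>C x"
    and scaleC_scaleC: "a *\<^sub>C b *\<^sub>C x = (a * b) *\<^sub>C x"
    and scaleC_one: "1 *\<^sub>C x = x"
    and scaleR_scaleC: "r *\<^sub>R x = complex_of_real r *\<^sub>C x"

text \<open>The inner product is linear in its first argument and conjugate-linear in its second.
  The norm and metric are those of \<^class>\<open>real_normed_vector\<close>, tied to the inner product by
  \<open>norm_eq_sqrt_cinner\<close>; the norm axioms inherited this way are redundant.\<close>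

class complex_inner = complex_vector + real_normed_vector +
  fixes cinner :: "'a \<Rightarrow> 'a \<Rightarrow> complex"
  assumes cinner_commute: "cinner x y = cnj (cinner y x)"
    and cinner_add_left: "cinner (x + y) z = cinner x z + cinner y z"
    and cinner_scaleC_left: "cinner (a *\<^sub>C x) y = a * cinner x y"
    and cinner_ge_zero: "0 \<le> Re (cinner x x)"
    and cinner_eq_zero_iff: "cinner x x = 0 \<longleftrightarrow> x = 0"
    and norm_eq_sqrt_cinner: "norm x = sqrt (Re (cinner x x))"

class chilbert_space = complex_inner + complete_space

instantiation complex :: chilbert_space
begin

definition scaleC_complex :: "complex \<Rightarrow> complex \<Rightarrow> complex"
  where "scaleC_complex a x = a * x"

definition cinner_complex :: "complex \<Rightarrow> complex \<Rightarrow> complex"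
  where "cinner_complex x y = x * cnj y"

instance
  by standard
    (auto simp: scaleC_complex_def cinner_complex_def algebra_simps scaleR_conv_of_real
      cmod_def power2_eq_square)

end

definition bounded_clinear :: "('a::complex_inner \<Rightarrow> 'b::complex_inner) \<Rightarrow> bool"
  where "bounded_clinear T \<longleftrightarrow> bounded_linear T \<and> (\<forall>a x. T (a *\<^sub>C x) = a *\<^sub>C T x)"

text \<open>For \<open>T\<close> bounded and complex-linear on a Hilbert space, the Riesz representation theorem gives
  exactly one function \<open>S\<close> with the property below.\<close>

definition cadjoint :: "('a::chilbert_space \<Rightarrow> 'a) \<Rightarrow> 'a \<Rightarrow> 'a"
  where "cadjoint T = (THE S. \<forall>x y. cinner (T x) y = cinner x (S y))"

text \<open>If the space is \<open>{0}\<close>, the sets below are empty and the real \<^const>\<open>Sup\<close> and \<^const>\<open>Inf\<close>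
  are unspecified, so these quantities are meaningful only on nonzero spaces.\<close>

definition numerical_radius :: "('a::complex_inner \<Rightarrow> 'a) \<Rightarrow> real"
  where "numerical_radius T = Sup {cmod (cinner (T x) x) | x. norm x = 1}"

definition crawford_number :: "('a::complex_inner \<Rightarrow> 'a) \<Rightarrow> real"
  where "crawford_number T = Inf {cmod (cinner (T x) x) | x. norm x = 1}"

definition davis_wielandt_radius :: "('a::complex_inner \<Rightarrow> 'a) \<Rightarrow> real"
  where "davis_wielandt_radius T =
    Sup {sqrt ((cmod (cinner (T x) x))\<^sup>2 + norm (T x) ^ 4) | x. norm x = 1}"

end

theory Submission
  imports Defs
begin

text \<open>Each inequality in (i) optimises one summand of \<open>|\<langle>Tx,x\<rangle>|\<^sup>2 + \<parallel>Tx\<parallel>\<^sup>4\<close> over unit vectors \<open>x\<close>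
  while estimating the other from below by its infimum, using \<open>\<langle>T\<^sup>*Tx,x\<rangle> = \<parallel>Tx\<parallel>\<^sup>2\<close>; (ii) follows by
  AM-GM. The adjoint exists by the Riesz representation theorem: the functional \<open>r\<close> is represented by
  the minimiser of \<open>\<parallel>x\<parallel>\<^sup>2 - 2 r x\<close>, which exists because minimising sequences are Cauchy by the
  parallelogram law.\<close>

section \<open>Inner product algebra and the Cauchy-Schwarz inequality\<close>

lemma cinner_add_right:
  "cinner (x::'a::complex_inner) (y + z) = cinner x y + cinner x z"
  by (metis cinner_add_left cinner_commute complex_cnj_add)

lemma cinner_scaleC_right:
  "cinner (x::'a::complex_inner) (a *\<^sub>C y) = cnj a * cinner x y"
  by (metis cinner_scaleC_left cinner_commute complex_cnj_mult)

lemma cinner_scaleR_left: "cinner (r *\<^sub>R x) (y::'a::complex_inner) = of_real r * cinner x y"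
  by (simp add: scaleR_scaleC cinner_scaleC_left)

lemma cinner_scaleR_right: "cinner (x::'a::complex_inner) (r *\<^sub>R y) = of_real r * cinner x y"
  by (simp add: scaleR_scaleC cinner_scaleC_right)

lemma norm_sq_eq_Re_cinner: "(norm (x::'a::complex_inner))\<^sup>2 = Re (cinner x x)"
  by (simp add: norm_eq_sqrt_cinner cinner_ge_zero)

lemma cinner_self: "cinner x (x::'a::complex_inner) = of_real ((norm x)\<^sup>2)"
proof -
  have "Im (cinner x x) = 0"
    using cinner_commute[of x x] by (simp add: complex_eq_iff)
  then show ?thesis
    unfolding norm_sq_eq_Re_cinner by (simp add: complex_eq_iff)
qed

lemma norm_sq_add:
  "(norm (x + y::'a::complex_inner))\<^sup>2 = (norm x)\<^sup>2 + (norm y)\<^sup>2 + 2 * Re (cinner x y)"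
proof -
  have "Re (cinner y x) = Re (cinner x y)"
    using cinner_commute[of y x] by simp
  then show ?thesis
    unfolding norm_sq_eq_Re_cinner by (simp add: cinner_add_left cinner_add_right)
qed

lemma norm_scaleC: "norm (a *\<^sub>C x::'a::complex_inner) = cmod a * norm x"
proof -
  have "cinner (a *\<^sub>C x) (a *\<^sub>C x) = of_real ((cmod a)\<^sup>2 * (norm x)\<^sup>2)"
    by (simp only: cinner_scaleC_left cinner_scaleC_right)
      (simp only: cinner_self of_real_mult complex_norm_square mult_ac)
  then have "(norm (a *\<^sub>C x))\<^sup>2 = (cmod a * norm x)\<^sup>2"
    unfolding norm_sq_eq_Re_cinner[of "a *\<^sub>C x"] by (simp add: power_mult_distrib)
  then show ?thesis
    by (simp add: power2_eq_iff_nonneg)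
qed

text \<open>The triangle inequality is available from the norm class, so Cauchy-Schwarz is read off
  by squaring it and cancelling the common terms.\<close>

lemma Re_cinner_le_norm: "Re (cinner x y) \<le> norm x * norm (y::'a::complex_inner)"
proof -
  have "(norm (x + y))\<^sup>2 \<le> (norm x + norm y)\<^sup>2"
    by (intro power_mono norm_triangle_ineq norm_ge_zero)
  then show ?thesis
    by (simp add: norm_sq_add power2_sum)
qed

lemma cmod_cinner_le_norm: "cmod (cinner x y) \<le> norm x * norm (y::'a::complex_inner)"
proof (cases "cinner x y = 0")
  case False
  define z where "z = cinner x y"
  \<comment> \<open>A unimodular factor that rotates \<open>z\<close> onto the positive real axis,
    so that the real-part bound for \<open>a *\<^sub>C x\<close> controls the full modulus.\<close>
  define a where "a = cnj z / of_real (cmod z)"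
  have "a * z = of_real (cmod z)"
    using False complex_norm_square[of z]
    by (simp add: a_def z_def power2_eq_square field_simps)
  moreover have "cmod a = 1"
    using False by (simp add: a_def z_def norm_divide)
  ultimately show ?thesis
    using Re_cinner_le_norm[of "a *\<^sub>C x" y]
    by (simp add: cinner_scaleC_left norm_scaleC z_def)
qed simp

lemma cinner_eqI:
  assumes "\<And>x. cinner x y = cinner x (z::'a::complex_inner)"
  shows "y = z"
proof -
  have "cinner (y - z) (y - z) + cinner (y - z) z = cinner (y - z) y"
    by (metis cinner_add_right diff_add_cancel)
  then have "cinner (y - z) (y - z) = 0"
    using assms[of "y - z"] by simp
  then show ?thesis
    by (simp add: cinner_eq_zero_iff)
qed

section \<open>Riesz representation by minimisation\<close>

lemma linear_coeff_eq_zero: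
  fixes a b :: real
  assumes "\<And>t. 0 \<le> t\<^sup>2 * a + t * b" and "0 \<le> a"
  shows "b = 0"
proof -
  \<comment> \<open>The denominator \<open>a + 1\<close> is positive even when \<open>a = 0\<close>,
    and at this point the quadratic takes the value \<open>- s\<^sup>2\<close>.\<close>
  define s where "s = - b / (a + 1)"
  have b: "b = - s * (a + 1)"
    using \<open>0 \<le> a\<close> by (simp add: s_def)
  have "0 \<le> s\<^sup>2 * a + s * b"
    by (rule assms)
  also have "\<dots> = - s\<^sup>2"
    unfolding b by (simp add: algebra_simps power2_eq_square)
  finally show ?thesis
    by (simp add: b)
qed

lemma riesz_representation_Re:
  fixes r :: "'a::chilbert_space \<Rightarrow> real"
  assumes "bounded_linear r"
  obtains y where "\<And>x. r x = Re (cinner x y)"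
proof -
  interpret r: bounded_linear r by fact
  obtain K where K: "\<And>x. norm (r x) \<le> norm x * K"
    using r.bounded by blast
  \<comment> \<open>If \<open>y\<close> represents \<open>r\<close>, then \<open>g x\<close> is the
    squared distance from \<open>x\<close> to \<open>y\<close> minus the squared norm of
    \<open>y\<close>, so \<open>y\<close> has to be the minimiser.\<close>
  define g where "g x = (norm x)\<^sup>2 - 2 * r x" for x
  define m where "m = Inf (range g)"
  \<comment> \<open>Completing the square: \<open>r x \<le> norm x * K\<close> makes
    \<open>g x\<close> at least \<open>(norm x - K)\<^sup>2 - K\<^sup>2\<close>.\<close>
  have "- K\<^sup>2 \<le> g x" for x
  proof -
    have "r x \<le> norm x * K"
      using K[of x] by simp
    moreover have "0 \<le> (norm x - K)\<^sup>2"
      by simp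
    ultimately show ?thesis
      unfolding g_def power2_diff by linarith
  qed
  then have bdd: "bdd_below (range g)"
    by (intro bdd_belowI[of _ "- K\<^sup>2"]) auto
  have m_le: "m \<le> g x" for x
    unfolding m_def using bdd by (intro cInf_lower) auto
  have "\<exists>x. g x < m + 1 / real (Suc n)" for n
    using cInf_lessD[of "range g" "m + 1 / real (Suc n)"] by (auto simp: m_def)
  then obtain X where X: "\<And>n. g (X n) < m + 1 / real (Suc n)"
    by metis
  \<comment> \<open>The linear parts cancel between the endpoints and the midpoint, leaving the
    parallelogram law for the norm.\<close>
  have parallelogram: "(norm (u - v))\<^sup>2 = 2 * (g u + g v - 2 * g ((1/2) *\<^sub>R (u + v)))" for u v
  proof -
    have "(norm (u - v))\<^sup>2 = (norm u)\<^sup>2 + (norm v)\<^sup>2 - 2 * Re (cinner u v)"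
      using norm_sq_add[of u "- v"] cinner_scaleR_right[of u "-1" v] by simp
    moreover have "(norm ((1/2) *\<^sub>R (u + v)))\<^sup>2 = (norm (u + v))\<^sup>2 / 4"
      by (simp add: power_divide)
    moreover have "r ((1/2) *\<^sub>R (u + v)) = (r u + r v) / 2"
      by (simp add: r.scaleR r.add)
    ultimately show ?thesis
      unfolding g_def norm_sq_add by argo
  qed
  have "Cauchy X"
  proof (rule metric_CauchyI)
    fix e :: real
    assume "0 < e"
    \<comment> \<open>With both values of \<open>g\<close> below \<open>m + e\<^sup>2 / 4\<close>
      and the midpoint value at least \<open>m\<close>, the identity bounds the squared distance by
      \<open>e\<^sup>2\<close>.\<close>
    then obtain N where N: "inverse (real (Suc N)) < e\<^sup>2 / 4"
      using reals_Archimedean[of "e\<^sup>2 / 4"] by auto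
    have near: "g (X n) < m + e\<^sup>2 / 4" if "n \<ge> N" for n
    proof -
      have "1 / real (Suc n) \<le> 1 / real (Suc N)"
        using that by (intro divide_left_mono) auto
      then show ?thesis
        using X[of n] N by (simp add: inverse_eq_divide)
    qed
    have "dist (X i) (X j) < e" if "i \<ge> N" "j \<ge> N" for i j
    proof -
      have "(norm (X i - X j))\<^sup>2 < e\<^sup>2"
        unfolding parallelogram
        using near[OF that(1)] near[OF that(2)] m_le[of "(1/2) *\<^sub>R (X i + X j)"] by argo
      then show ?thesis
        using \<open>0 < e\<close> by (simp add: dist_norm power_less_imp_less_base)
    qed
    then show "\<exists>M. \<forall>i\<ge>M. \<forall>j\<ge>M. dist (X i) (X j) < e"
      by blast
  qed
  then obtain y where "X \<longlonglongrightarrow> y"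
    using Cauchy_convergent convergent_def by blast
  then have "(\<lambda>n. g (X n)) \<longlonglongrightarrow> g y"
    unfolding g_def by (intro tendsto_intros r.tendsto)
  moreover have "(\<lambda>n. m + 1 / real (Suc n)) \<longlonglongrightarrow> m + 0"
    using LIMSEQ_inverse_real_of_nat by (intro tendsto_add) (simp_all add: inverse_eq_divide)
  ultimately have "g y \<le> m + 0"
    by (rule LIMSEQ_le) (use X less_imp_le in blast)
  then have min: "g y \<le> g x" for x
    using m_le[of x] by simp
  have "r x = Re (cinner x y)" for x
  proof -
    \<comment> \<open>First-order condition at the minimiser: this is the coefficient of
      \<open>t\<close> in \<open>g (t *\<^sub>R x + y) - g y\<close>, which is nonnegative for every
      real \<open>t\<close>.\<close>
    have "2 * (Re (cinner x y) - r x) = 0"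
    proof (rule linear_coeff_eq_zero)
      show "0 \<le> t\<^sup>2 * (norm x)\<^sup>2 + t * (2 * (Re (cinner x y) - r x))" for t
        using min[of "t *\<^sub>R x + y"] unfolding g_def norm_sq_add
        by (simp add: r.add r.scaleR cinner_scaleR_left power_mult_distrib algebra_simps)
    qed simp
    then show ?thesis
      by simp
  qed
  then show thesis
    by (rule that)
qed

text \<open>A complex-linear functional is determined by its real part, since the imaginary part at
  \<open>x\<close> is minus the real part at \<open>\<i> *\<^sub>C x\<close>.\<close>

lemma riesz_representation:
  fixes f :: "'a::chilbert_space \<Rightarrow> complex"
  assumes "bounded_linear f" and scaleC: "\<And>a x. f (a *\<^sub>C x) = a * f x"
  obtains y where "\<And>x. f x = cinner x y"
proof -
  obtain y where y: "\<And>x. Re (f x) = Re (cinner x y)"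
    using riesz_representation_Re[of "\<lambda>x. Re (f x)"] assms(1)
    by (metis bounded_linear_Re bounded_linear_compose)
  have "Im (f x) = Im (cinner x y)" for x
    using y[of "\<i> *\<^sub>C x"] by (simp add: scaleC cinner_scaleC_left)
  with y have "\<And>x. f x = cinner x y"
    by (simp add: complex_eq_iff)
  then show thesis
    by (rule that)
qed

section \<open>The adjoint\<close>

lemma cinner_cadjoint:
  fixes T :: "'a::chilbert_space \<Rightarrow> 'a"
  assumes "bounded_clinear T"
  shows "cinner (T x) y = cinner x (cadjoint T y)"
proof -
  interpret T: bounded_linear T
    using assms by (simp add: bounded_clinear_def)
  obtain K where K: "\<And>x. norm (T x) \<le> norm x * K"
    using T.bounded by blast
  \<comment> \<open>For fixed \<open>y\<close>, Riesz represents the functional sending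
    \<open>x\<close> to \<open>cinner (T x) y\<close>; choice then collects the representing vectors
    into \<open>S\<close>.\<close>
  have "\<exists>z. \<forall>x. cinner (T x) y = cinner x z" for y
  proof -
    have "bounded_linear (\<lambda>x. cinner (T x) y)"
    proof (rule bounded_linear_intro)
      show "norm (cinner (T x) y) \<le> norm x * (K * norm y)" for x
        using cmod_cinner_le_norm[of "T x" y] mult_right_mono[OF K[of x] norm_ge_zero[of y]]
        by (simp add: mult.assoc)
    qed (simp_all add: T.add T.scaleR cinner_add_left cinner_scaleR_left scaleR_conv_of_real)
    moreover have "cinner (T (a *\<^sub>C x)) y = a * cinner (T x) y" for a x
      using assms by (simp add: bounded_clinear_def cinner_scaleC_left)
    ultimately obtain z where "\<And>x. cinner (T x) y = cinner x z"
      using riesz_representation[of "\<lambda>x. cinner (T x) y"] by blast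
    then show ?thesis
      by blast
  qed
  then have "\<exists>S. \<forall>y x. cinner (T x) y = cinner x (S y)"
    by (intro choice allI)
  then obtain S where S: "\<forall>x y. cinner (T x) y = cinner x (S y)"
    by blast
  \<comment> \<open>Uniqueness, without which the definite description in \<open>cadjoint\<close>
    could not be unfolded.\<close>
  moreover have "S' = S" if "\<forall>x y. cinner (T x) y = cinner x (S' y)" for S'
  proof
    show "S' y = S y" for y
      by (rule cinner_eqI) (simp only: S[rule_format, symmetric] that[rule_format, symmetric])
  qed
  ultimately have "\<forall>x y. cinner (T x) y = cinner x (cadjoint T y)"
    unfolding cadjoint_def by (rule theI)
  then show ?thesis
    by blast
qed

text \<open>Identifies the Crawford number of \<open>cadjoint T \<circ> T\<close> as the infimum of
  \<open>(norm (T x))\<^sup>2\<close> over unit vectors.\<close>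

lemma cinner_cadjoint_comp_self:
  fixes T :: "'a::chilbert_space \<Rightarrow> 'a"
  assumes "bounded_clinear T"
  shows "cmod (cinner ((cadjoint T \<circ> T) x) x) = (norm (T x))\<^sup>2"
proof -
  have "cinner ((cadjoint T \<circ> T) x) x = cnj (cinner (T x) (T x))"
    using cinner_cadjoint[OF assms] cinner_commute[of "cadjoint T (T x)" x] by simp
  then show ?thesis
    by (simp add: cinner_self norm_power)
qed

section \<open>Extremal quantities over the unit sphere\<close>

lemma crawford_number_le:
  assumes "norm x = 1"
  shows "crawford_number T \<le> cmod (cinner (T x) x)"
  unfolding crawford_number_def
  using assms by (intro cInf_lower bdd_belowI[of _ 0]) auto

text \<open>The unit vector only witnesses that the infimum is taken over a nonempty set.\<close>

lemma crawford_number_nonneg: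
  assumes "norm (x::'a::complex_inner) = 1"
  shows "0 \<le> crawford_number (T :: 'a \<Rightarrow> 'a)"
  unfolding crawford_number_def using assms by (intro cInf_greatest) auto

lemma davis_wielandt_radius_ge:
  fixes T :: "'a::complex_inner \<Rightarrow> 'a"
  assumes "bounded_linear T" and "norm x = 1"
  shows "(cmod (cinner (T x) x))\<^sup>2 + norm (T x) ^ 4 \<le> (davis_wielandt_radius T)\<^sup>2"
proof -
  let ?h = "\<lambda>x. sqrt ((cmod (cinner (T x) x))\<^sup>2 + norm (T x) ^ 4)"
  \<comment> \<open>A uniform bound, so that the real supremum really is an upper bound of its
    set.\<close>
  have "?h u \<le> sqrt ((onorm T)\<^sup>2 + onorm T ^ 4)" if "norm u = 1" for u
  proof -
    have "norm (T u) \<le> onorm T"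
      using onorm[OF assms(1), of u] that by simp
    moreover from this have "cmod (cinner (T u) u) \<le> onorm T"
      using cmod_cinner_le_norm[of "T u" u] that by simp
    ultimately show ?thesis
      by (intro real_sqrt_le_mono add_mono power_mono) auto
  qed
  then have "?h x \<le> davis_wielandt_radius T"
    unfolding davis_wielandt_radius_def using assms(2)
    by (intro cSup_upper bdd_aboveI[of _ "sqrt ((onorm T)\<^sup>2 + onorm T ^ 4)"]) auto
  then have "(?h x)\<^sup>2 \<le> (davis_wielandt_radius T)\<^sup>2"
    by (intro power_mono) auto
  then show ?thesis
    by simp
qed

text \<open>The supremum is bounded by \<open>sqrt B\<close> and then squared. The unit vector gives
  both nonemptiness and \<open>0 \<le> B\<close>.\<close>

lemma numerical_radius_sq_le:
  fixes T :: "'a::complex_inner \<Rightarrow> 'a"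
  assumes "norm (x::'a) = 1" and "\<And>x. norm x = 1 \<Longrightarrow> (cmod (cinner (T x) x))\<^sup>2 \<le> B"
    and "0 \<le> numerical_radius T"
  shows "(numerical_radius T)\<^sup>2 \<le> B"
proof -
  have "numerical_radius T \<le> sqrt B"
    unfolding numerical_radius_def using assms(1,2)
    by (intro cSup_least) (auto intro: real_le_rsqrt)
  then have "(numerical_radius T)\<^sup>2 \<le> (sqrt B)\<^sup>2"
    using assms(3) by (intro power_mono)
  also have "\<dots> = B"
    using assms(2)[OF assms(1)] by (simp add: order_trans[OF zero_le_power2])
  finally show ?thesis .
qed

lemma numerical_radius_nonneg:
  fixes T :: "'a::complex_inner \<Rightarrow> 'a"
  assumes "bounded_linear T" and "norm (x::'a) = 1"
  shows "0 \<le> numerical_radius T"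
proof -
  have "cmod (cinner (T u) u) \<le> onorm T" if "norm u = 1" for u
    using cmod_cinner_le_norm[of "T u" u] onorm[OF assms(1), of u] that by simp
  then have "cmod (cinner (T x) x) \<le> numerical_radius T"
    unfolding numerical_radius_def using assms(2)
    by (intro cSup_upper bdd_aboveI[of _ "onorm T"]) auto
  then show ?thesis
    using norm_ge_zero order_trans by blast
qed

lemma onorm_pow4_le:
  fixes T :: "'a::real_normed_vector \<Rightarrow> 'b::real_normed_vector"
  assumes "bounded_linear T" and "\<And>x. norm x = 1 \<Longrightarrow> norm (T x) ^ 4 \<le> B" and "0 \<le> B"
  shows "onorm T ^ 4 \<le> B"
proof -
  interpret T: bounded_linear T by fact
  \<comment> \<open>Homogeneity carries the bound from the unit sphere to all vectors, as
    \<open>onorm\<close> requires.\<close>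
  have "norm (T x) \<le> root 4 B * norm x" for x
  proof (cases "x = 0")
    case False
    then have "norm (T (x /\<^sub>R norm x)) ^ 4 \<le> B"
      by (intro assms(2)) simp
    then have "root 4 (norm (T (x /\<^sub>R norm x)) ^ 4) \<le> root 4 B"
      by simp
    then have "norm (T (x /\<^sub>R norm x)) \<le> root 4 B"
      by (simp add: real_root_power_cancel)
    then show ?thesis
      using False by (simp add: T.scaleR field_simps)
  qed (simp add: T.zero)
  then have "onorm T \<le> root 4 B"
    by (intro onorm_bound) (simp_all add: \<open>0 \<le> B\<close>)
  then have "onorm T ^ 4 \<le> root 4 B ^ 4"
    by (intro power_mono onorm_pos_le assms(1))
  then show ?thesis
    using \<open>0 \<le> B\<close> by simp
qed

theorem theorem2p4:
  fixes T :: "'a::chilbert_space \<Rightarrow> 'a"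
  assumes "bounded_clinear T"
    and "\<exists>x::'a. x \<noteq> 0"
  shows "(davis_wielandt_radius T)\<^sup>2 \<ge>
           max ((numerical_radius T)\<^sup>2 + (crawford_number (cadjoint T \<circ> T))\<^sup>2)
               (onorm T ^ 4 + (crawford_number T)\<^sup>2) \<and>
         (davis_wielandt_radius T)\<^sup>2 \<ge>
           2 * max (numerical_radius T * crawford_number (cadjoint T \<circ> T))
                   (crawford_number T * (onorm T)\<^sup>2)"
proof -
  let ?D = "davis_wielandt_radius T" and ?w = "numerical_radius T"
    and ?c = "crawford_number T" and ?c' = "crawford_number (cadjoint T \<circ> T)"
  have T: "bounded_linear T"
    using assms(1) by (simp add: bounded_clinear_def)
  from assms(2) obtain v :: 'a where "v \<noteq> 0" ..
  then have e: "norm (v /\<^sub>R norm v) = 1"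
    by simp
  note dw = davis_wielandt_radius_ge[OF T]
  have c: "?c\<^sup>2 \<le> (cmod (cinner (T x) x))\<^sup>2" if "norm x = 1" for x
    using crawford_number_nonneg[OF e] crawford_number_le[OF that] by (rule power_mono[rotated])
  have c': "?c'\<^sup>2 \<le> norm (T x) ^ 4" if "norm x = 1" for x
  proof -
    have "?c' \<le> (norm (T x))\<^sup>2"
      using crawford_number_le[OF that, of "cadjoint T \<circ> T"]
      unfolding cinner_cadjoint_comp_self[OF assms(1)] .
    then have "?c'\<^sup>2 \<le> ((norm (T x))\<^sup>2)\<^sup>2"
      using crawford_number_nonneg[OF e] by (rule power_mono)
    then show ?thesis
      by simp
  qed
  have 1: "?w\<^sup>2 + ?c'\<^sup>2 \<le> ?D\<^sup>2"
  proof -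
    \<comment> \<open>With the second summand replaced by its lower bound and moved to the right,
      the right side is independent of \<open>x\<close> and the supremum can be taken.\<close>
    have "?w\<^sup>2 \<le> ?D\<^sup>2 - ?c'\<^sup>2"
    proof (rule numerical_radius_sq_le[OF e _ numerical_radius_nonneg[OF T e]])
      show "(cmod (cinner (T x) x))\<^sup>2 \<le> ?D\<^sup>2 - ?c'\<^sup>2" if "norm x = 1" for x
        using dw[OF that] c'[OF that] by linarith
    qed
    then show ?thesis
      by simp
  qed
  have 2: "onorm T ^ 4 + ?c\<^sup>2 \<le> ?D\<^sup>2"
  proof -
    have B: "norm (T x) ^ 4 \<le> ?D\<^sup>2 - ?c\<^sup>2" if "norm x = 1" for x
      using dw[OF that] c[OF that] by linarith
    \<comment> \<open>Holds because a unit vector exists: the bound \<open>B\<close> there dominates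
      a fourth power.\<close>
    moreover have "0 \<le> ?D\<^sup>2 - ?c\<^sup>2"
      by (rule order_trans[OF _ B[OF e]]) simp
    ultimately have "onorm T ^ 4 \<le> ?D\<^sup>2 - ?c\<^sup>2"
      by (rule onorm_pow4_le[OF T])
    then show ?thesis
      by simp
  qed
  have "2 * (?w * ?c') \<le> ?D\<^sup>2"
    using 1 sum_squares_bound[of ?w ?c'] by (simp add: mult.assoc)
  moreover have "2 * (?c * (onorm T)\<^sup>2) \<le> ?D\<^sup>2"
    using 2 sum_squares_bound[of ?c "(onorm T)\<^sup>2"] by (simp add: mult.assoc)
  ultimately show ?thesis
    using 1 2 by (simp add: max_def)
qed

end
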